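(* Let $n\in\mathbb N$. With the matrices $\sigma_1(q^2,n)$, $\sigma_2(q^2,n)$, $D_n(q^2)$, the operation $\sharp$, the $q$-exponential $\exp_{(q^2)}$ and the highest weight representation $\rho_{1,n}$ of $U_q(\mathfrak{sl}_2)$ defined in the context, for $q\neq 1$ we have $$\sigma_1(q^2,n)\,D_n^\sharp(q^2)=\exp_{(q^2)}\left(q^{n/2}\rho_{1,n}(EK^{1/2})\right)D_n^\sharp(q^2),$$ $$D_n(q^2)\,\sigma_2(q^2,n)=\exp_{(q^2)}\left(-q^{n/2}\rho_{1,n}(FK^{-1/2})\right)D_n(q^2).$$
   Context: Here $q$ is a complex parameter. All matrices are complex of size $(n+1)\times(n+1)$, with rows and columns indexed by $0,1,\dots,n$. For a matrix $A=(a_{ij})_{0\le i,j\le n}$ put $A^\sharp=(a^\sharp_{ij})$ with $a^\sharp_{ij}=a_{n-i,n-j}$. For a parameter $p$ put $(m)_p=\frac{p^m-1}{p-1}$, $(m)!_p=(1)_p(2)_p\cdots(m)_p$, $(0)!_p=1$, and let $\binom{m}{k}_p=\frac{(m)!_p}{(k)!_p\,(m-k)!_p}$ for $0\le k\le m$ be the Gaussian polynomials ($p$-binomial coefficients), with $\binom{m}{k}_p=0$ for $k>m$. Also put $[m]=[m]_q=\frac{q^m-q^{-m}}{q-q^{-1}}$. For a parameter $p$ the matrices are as follows. $\sigma_1(p,n)$ is the upper triangular $p$-Pascal matrix with entries $\sigma_1(p,n)_{km}=\binom{n-k}{n-m}_p$, $0\le k,m\le n$ (for example $\sigma_1(p,2)=\begin{pmatrix}1&1+p&1\\0&1&1\\0&0&1\end{pmatrix}$).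 $\sigma_2(p,n)=\left(\sigma_1(p^{-1},n)^{-1}\right)^\sharp$. $D_n(p)=\mathrm{diag}(p_r)_{r=0}^n$ with $p_r=p^{(r-1)r/2}$, and $D_n^\sharp(p)=(D_n(p))^\sharp$. The exponential is $\exp_{(p)}(M)=\sum_{m=0}^{\infty}\frac{1}{(m)!_p}M^m$; it is applied here to matrices $M$ with $M^{n+1}=0$, so that only the terms with $m\le n$ contribute. $U_q(\mathfrak{sl}_2)$ is the algebra generated by $E,F,K,K^{-1}$ with relations $KK^{-1}=K^{-1}K=1$, $KEK^{-1}=q^2E$, $KFK^{-1}=q^{-2}F$, $[E,F]=\frac{K-K^{-1}}{q-q^{-1}}$. The representation $\rho_{1,n}$ on $\mathbb C^{n+1}$ is given by: $\rho_{1,n}(E)_{k,k+1}=[n-k]$ for $0\le k\le n-1$ and other entries zero; $\rho_{1,n}(F)_{k,k-1}=[k]$ for $1\le k\le n$ and other entries zero; $\rho_{1,n}(K)=\mathrm{diag}(q^n,q^{n-2},\dots,q^{-n+2},q^{-n})$. Here $\rho_{1,n}(K^{\pm1/2})=\mathrm{diag}(q^{\pm(n-2k)/2})_{k=0}^n$, with the same square root $q^{1/2}$ as in $q^{n/2}$, and $\rho_{1,n}(EK^{1/2})=\rho_{1,n}(E)\rho_{1,n}(K^{1/2})$, $\rho_{1,n}(FK^{-1/2})=\rho_{1,n}(F)\rho_{1,n}(K^{-1/2})$. *)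

theory Defs
  imports
    Complex_Main
    "Jordan_Normal_Form.Determinant"
    "Jordan_Normal_Form.Gauss_Jordan_Elimination"
begin

definition qnum :: "complex \<Rightarrow> nat \<Rightarrow> complex" where
  "qnum p m = (p ^ m - 1) / (p - 1)"

definition qfact :: "complex \<Rightarrow> nat \<Rightarrow> complex" where
  "qfact p m = (\<Prod>k=1..m. qnum p k)"

definition qbinom :: "complex \<Rightarrow> nat \<Rightarrow> nat \<Rightarrow> complex" where
  "qbinom p m k = (if k \<le> m then qfact p m / (qfact p k * qfact p (m - k)) else 0)"

definition qbracket :: "complex \<Rightarrow> nat \<Rightarrow> complex" where
  "qbracket q m = (q ^ m - inverse q ^ m) / (q - inverse q)"

definition sharp :: "complex mat \<Rightarrow> complex mat" where
  "sharp A = mat (dim_row A) (dim_col A)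
     (\<lambda>(i, j). A $$ (dim_row A - 1 - i, dim_col A - 1 - j))"

definition sigma1 :: "complex \<Rightarrow> nat \<Rightarrow> complex mat" where
  "sigma1 p n = mat (n + 1) (n + 1) (\<lambda>(k, m). qbinom p (n - k) (n - m))"

text \<open>The matrix \<open>sigma1 (inverse p) n\<close> is invertible as soon as the \<open>p\<close>-factorials up to
  \<open>n\<close> do not vanish, see \<open>sigma1_inverse\<close> below; otherwise \<open>the\<close> may return an unspecified value.\<close>

definition sigma2 :: "complex \<Rightarrow> nat \<Rightarrow> complex mat" where
  "sigma2 p n = sharp (the (mat_inverse (sigma1 (inverse p) n)))"

definition Dmat :: "complex \<Rightarrow> nat \<Rightarrow> complex mat" where
  "Dmat p n = mat_diag (n + 1) (\<lambda>r. p ^ ((r - 1) * r div 2))"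

text \<open>The series is taken entrywise. For nilpotent \<open>M\<close> it is a finite sum; summands with
  \<open>M ^\<^sub>m m = 0\<close> vanish even if \<open>qfact p m = 0\<close>.\<close>

definition qexp :: "complex \<Rightarrow> complex mat \<Rightarrow> complex mat" where
  "qexp p M = mat (dim_row M) (dim_col M) (\<lambda>(i, j). \<Sum>m. 1 / qfact p m * (M ^\<^sub>m m) $$ (i, j))"

definition rho_E :: "complex \<Rightarrow> nat \<Rightarrow> complex mat" where
  "rho_E q n = mat (n + 1) (n + 1) (\<lambda>(k, m). if m = k + 1 then qbracket q (n - k) else 0)"

definition rho_F :: "complex \<Rightarrow> nat \<Rightarrow> complex mat" where
  "rho_F q n = mat (n + 1) (n + 1) (\<lambda>(k, m). if k = m + 1 then qbracket q k else 0)"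

definition rho_K :: "complex \<Rightarrow> nat \<Rightarrow> complex mat" where
  "rho_K q n = mat_diag (n + 1) (\<lambda>k. q powi (int n - 2 * int k))"

definition rho_K_inv :: "complex \<Rightarrow> nat \<Rightarrow> complex mat" where
  "rho_K_inv q n = mat_diag (n + 1) (\<lambda>k. q powi (- (int n - 2 * int k)))"

text \<open>In the next two definitions \<open>s\<close> is the chosen square root of \<open>q\<close>, so that
  \<open>s powi j\<close> stands for \<open>q\<close> to the power \<open>j / 2\<close>.\<close>

definition rho_K_half :: "complex \<Rightarrow> nat \<Rightarrow> complex mat" where
  "rho_K_half s n = mat_diag (n + 1) (\<lambda>k. s powi (int n - 2 * int k))"

definition rho_K_half_inv :: "complex \<Rightarrow> nat \<Rightarrow> complex mat" where
  "rho_K_half_inv s n = mat_diag (n + 1) (\<lambda>k. s powi (- (int n - 2 * int k)))"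

lemma qfact_nonzero:
  assumes "\<And>k. 1 \<le> k \<Longrightarrow> k \<le> n \<Longrightarrow> p ^ k \<noteq> 1" and "m \<le> n"
  shows "qfact p m \<noteq> 0"
proof -
  have "qnum p k \<noteq> 0" if "k \<in> {1..m}" for k
    using assms(1)[of k] assms(1)[of 1] that assms(2) by (simp add: qnum_def)
  then show ?thesis
    by (simp add: qfact_def)
qed

lemma sigma1_inverse:
  assumes "\<And>k. 1 \<le> k \<Longrightarrow> k \<le> n \<Longrightarrow> p ^ k \<noteq> 1"
  shows "\<exists>B. mat_inverse (sigma1 (inverse p) n) = Some B \<and> B \<in> carrier_mat (n + 1) (n + 1) \<and>
           sigma1 (inverse p) n * B = 1\<^sub>m (n + 1) \<and> B * sigma1 (inverse p) n = 1\<^sub>m (n + 1)"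
proof -
  let ?A = "sigma1 (inverse p) n"
  have A: "?A \<in> carrier_mat (n + 1) (n + 1)"
    by (simp add: sigma1_def)
  have "inverse p ^ k \<noteq> 1" if "1 \<le> k" "k \<le> n" for k
    using assms[OF that] by (metis inverse_1 inverse_inverse_eq power_inverse)
  then have nz: "qfact (inverse p) m \<noteq> 0" if "m \<le> n" for m
    using qfact_nonzero that by blast
  have "upper_triangular ?A"
    by (auto simp: upper_triangular_def sigma1_def qbinom_def)
  moreover have "?A $$ (k, k) = 1" if "k < n + 1" for k
    using that nz[of "n - k"] by (simp add: sigma1_def qbinom_def) (simp add: qfact_def)
  ultimately have "det ?A = 1"
    using det_upper_triangular[OF _ A] A by (auto simp: prod_list_diag_prod)
  then have "?A \<in> Units (ring_mat TYPE(complex) (n + 1) ())"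
    using det_non_zero_imp_unit[OF A] by simp
  then obtain B where "mat_inverse ?A = Some B"
    using mat_inverse(1)[OF A] by fastforce
  then show ?thesis
    using mat_inverse(2)[OF A] by blast
qed

text \<open>The matrices define a representation of the quantum group: all defining relations hold.\<close>

lemma rho_K_relations:
  assumes "q \<noteq> 0"
  shows "rho_K q n * rho_K_inv q n = 1\<^sub>m (n + 1)" "rho_K_inv q n * rho_K q n = 1\<^sub>m (n + 1)"
proof -
  have "q powi j * q powi (- j) = 1" "q powi (- j) * q powi j = 1" for j
    using assms by (simp_all add: power_int_minus)
  then show "rho_K q n * rho_K_inv q n = 1\<^sub>m (n + 1)"
      "rho_K_inv q n * rho_K q n = 1\<^sub>m (n + 1)"
    unfolding rho_K_def rho_K_inv_def mat_diag_diag by (simp_all only: mat_diag_one)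
qed

lemma rho_KE_relation:
  assumes "q \<noteq> 0"
  shows "rho_K q n * rho_E q n * rho_K_inv q n = q ^ 2 \<cdot>\<^sub>m rho_E q n"
proof -
  have E: "rho_E q n \<in> carrier_mat (n + 1) (n + 1)"
    by (simp add: rho_E_def)
  show ?thesis
    unfolding rho_K_def rho_K_inv_def mat_diag_mult_left[OF E]
    by (subst mat_diag_mult_right[where nr = "n + 1"])
      (use assms in \<open>auto simp: rho_E_def power_int_diff power_int_minus power_int_add
        power2_eq_square field_simps intro!: eq_matI\<close>)
qed

lemma rho_KF_relation:
  assumes "q \<noteq> 0"
  shows "rho_K q n * rho_F q n * rho_K_inv q n = inverse q ^ 2 \<cdot>\<^sub>m rho_F q n"
proof -
  have F: "rho_F q n \<in> carrier_mat (n + 1) (n + 1)"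
    by (simp add: rho_F_def)
  show ?thesis
    unfolding rho_K_def rho_K_inv_def mat_diag_mult_left[OF F]
    by (subst mat_diag_mult_right[where nr = "n + 1"])
      (use assms in \<open>auto simp: rho_F_def power_int_diff power_int_minus power_int_add
        power2_eq_square field_simps intro!: eq_matI\<close>)
qed

lemma rho_EF_relation:
  assumes "q \<noteq> 0" "q ^ 2 \<noteq> 1"
  shows "rho_E q n * rho_F q n - rho_F q n * rho_E q n =
           inverse (q - inverse q) \<cdot>\<^sub>m (rho_K q n - rho_K_inv q n)"
proof (rule eq_matI, goal_cases)
  case (1 i j)
  then have i: "i \<le> n" and j: "j \<le> n"
    by (auto simp: rho_K_def rho_K_inv_def mat_diag_def)
  have EF: "(rho_E q n * rho_F q n) $$ (i, j) =
      (if i = j then qbracket q (n - i) * qbracket q (i + 1) else 0)"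
  proof -
    have "(rho_E q n * rho_F q n) $$ (i, j) = (\<Sum>l\<in>{0..<n+1}.
        (if l = i + 1 then qbracket q (n - i) else 0) * (if l = j + 1 then qbracket q l else 0))"
      using i j by (simp add: rho_E_def rho_F_def scalar_prod_def)
    also have "\<dots> = (\<Sum>l\<in>{0..<n+1}. if l = i + 1 then
        (if i = j then qbracket q (n - i) * qbracket q (i + 1) else 0) else 0)"
      by (rule sum.cong) auto
    also have "\<dots> = (if i = j then qbracket q (n - i) * qbracket q (i + 1) else 0)"
      using i by (auto simp: qbracket_def)
    finally show ?thesis .
  qed
  have q0: "qbracket q 0 = 0"
    by (simp add: qbracket_def)
  have FE: "(rho_F q n * rho_E q n) $$ (i, j) =
      (if i = j then qbracket q i * qbracket q (n + 1 - i) else 0)"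
  proof -
    have "(rho_F q n * rho_E q n) $$ (i, j) = (\<Sum>l\<in>{0..<n+1}.
        (if i = l + 1 then qbracket q i else 0) * (if j = l + 1 then qbracket q (n - l) else 0))"
      using i j by (simp add: rho_E_def rho_F_def scalar_prod_def)
    also have "\<dots> = (\<Sum>l\<in>{0..<n+1}. if l = i - 1 then
        (if i = j then qbracket q i * qbracket q (n + 1 - i) else 0) else 0)"
      by (rule sum.cong, simp, cases i) (auto simp: q0)
    also have "\<dots> = (if i = j then qbracket q i * qbracket q (n + 1 - i) else 0)"
      using i by auto
    finally show ?thesis .
  qed
  have d: "q - inverse q \<noteq> 0"
    using assms by (auto simp: field_simps power2_eq_square)
  have "qbracket q (n - i) * qbracket q (i + 1) - qbracket q i * qbracket q (n + 1 - i) =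
      inverse (q - inverse q) * (q powi (int n - 2 * int i) - q powi (- (int n - 2 * int i)))"
  proof -
    obtain a where a: "n = a + i"
      using i le_Suc_ex by (metis add.commute)
    define x where "x = q ^ a"
    define y where "y = q ^ i"
    have nz: "x \<noteq> 0" "y \<noteq> 0"
      using assms by (auto simp: x_def y_def)
    have P: "q powi (int n - 2 * int i) = x / y" "q powi (- (int n - 2 * int i)) = y / x"
      using assms by (simp_all add: a x_def y_def power_int_diff power_int_add)
    have B: "qbracket q (n - i) = (x - 1 / x) / (q - inverse q)"
        "qbracket q (i + 1) = (q * y - 1 / (q * y)) / (q - inverse q)"
        "qbracket q i = (y - 1 / y) / (q - inverse q)"
        "qbracket q (n + 1 - i) = (q * x - 1 / (q * x)) / (q - inverse q)"
      by (simp_all add: a x_def y_def qbracket_def power_one_over inverse_eq_divide)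
    have "(x - 1 / x) * (q * y - 1 / (q * y)) - (y - 1 / y) * (q * x - 1 / (q * x)) =
        (q - inverse q) * (x / y - y / x)"
      using nz assms by (simp add: field_simps)
    then show ?thesis
      unfolding P B using d by (simp add: divide_simps)
  qed
  then show ?case
    using i j EF FE
    by (auto simp: rho_K_def rho_K_inv_def mat_diag_def index_minus_mat
        rho_E_def rho_F_def)
qed (auto simp: rho_E_def rho_F_def rho_K_def rho_K_inv_def mat_diag_def)

end

theory Submission
  imports Defs
begin

text \<open>
  With \<open>p = q\<^sup>2\<close> one has \<open>q\<^sup>m\<^sup>-\<^sup>1 [m] = (m)\<^sub>p\<close>, so the arguments of the two exponentials are shift
  matrices with entries \<open>(n - k)\<^sub>p\<close> above and \<open>- (k)\<^sub>p\<close> below the diagonal. Writing these entries as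
  quotients \<open>u k / u l\<close> with \<open>u k = (n - k)!\<^sub>p\<close> and \<open>u k = (-1)\<^sup>k (k)!\<^sub>p\<close> makes all powers, and hence
  the exponentials, explicit: they have entries \<open>p\<close>-binomial coefficients up to sign. The inverse
  in \<open>\<sigma>\<^sub>2\<close> is computed from the Gauss identity \<open>\<Sum>\<^sub>j (-1)\<^sup>j r\<^sup>j\<^sup>(\<^sup>j\<^sup>-\<^sup>1\<^sup>)\<^sup>/\<^sup>2 (N choose j)\<^sub>r = 0\<close> for
  \<open>N > 0\<close>, taken at \<open>r = 1 / p\<close>; conjugation by \<open>D\<^sub>n\<close> absorbs the powers of \<open>p\<close> because
  \<open>(m)!\<^sub>p = p\<^sup>m\<^sup>(\<^sup>m\<^sup>-\<^sup>1\<^sup>)\<^sup>/\<^sup>2 (m)!\<^sub>r\<close>.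
\<close>

section \<open>Exponentials of weighted shift matrices\<close>

text \<open>The quotients telescope: the only path of \<open>r\<close> unit steps starting at
  \<open>i\<close> ends at \<open>i + r\<close> and has weight
  \<open>u i / u (i + r)\<close>.\<close>

lemma shift_mat_power:
  fixes u :: "nat \<Rightarrow> complex"
  assumes u: "\<And>i. i < N \<Longrightarrow> u i \<noteq> 0"
  shows "mat N N (\<lambda>(i, j). if j = Suc i then u i / u j else 0) ^\<^sub>m r =
    mat N N (\<lambda>(i, j). if j = i + r then u i / u j else 0)"
proof (induction r)
  case 0
  show ?case
    using u by (auto intro!: eq_matI)
next
  case (Suc r)
  show ?case
  proof (rule eq_matI, goal_cases)
    case (1 i j)
    then have ij: "i < N" "j < N"
      by auto
    have "(mat N N (\<lambda>(i, j). if j = Suc i then u i / u j else 0) ^\<^sub>m Suc r) $$ (i, j) =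
        (\<Sum>l = 0..<N. (if l = i + r then u i / u l else 0) * (if j = Suc l then u l / u j else 0))"
      using ij by (simp add: Suc.IH scalar_prod_def)
    also have "\<dots> = (\<Sum>l = 0..<N. if l = i + r then (if j = i + Suc r then u i / u j else 0) else 0)"
      using u by (intro sum.cong) auto
    also have "\<dots> = (if j = i + Suc r then u i / u j else 0)"
      using ij by auto
    finally show ?case
      using ij by simp
  qed simp_all
qed

text \<open>In the entry \<open>(i, j)\<close> only the summand \<open>m = j - i\<close> of the
  series can survive, so the infinite sum is finite and raises no question of convergence.\<close>

lemma qexp_shift_mat:
  fixes u :: "nat \<Rightarrow> complex"
  assumes u: "\<And>i. i < N \<Longrightarrow> u i \<noteq> 0"
  shows "qexp p (mat N N (\<lambda>(i, j). if j = Suc i then u i / u j else 0)) =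
    mat N N (\<lambda>(i, j). if i \<le> j then u i / (u j * qfact p (j - i)) else 0)"
proof (rule eq_matI, goal_cases)
  case (1 i j)
  then have ij: "i < N" "j < N"
    by auto
  have "(\<Sum>m. 1 / qfact p m * (if j = i + m then u i / u j else 0)) =
      (\<Sum>m \<in> (if i \<le> j then {j - i} else {}). 1 / qfact p m * (if j = i + m then u i / u j else 0))"
    by (rule suminf_finite) (auto split: if_splits)
  then show ?case
    using ij by (simp add: qexp_def shift_mat_power[OF u] mult.commute)
qed (simp_all add: qexp_def)

text \<open>Matrix powers unfold on the right; transposition reverses products, so the induction for
  transposes needs the left-hand form.\<close>

lemma pow_mat_Suc_left:
  fixes A :: "'a :: semiring_1 mat"
  assumes A: "A \<in> carrier_mat N N"
  shows "A ^\<^sub>m Suc r = A * A ^\<^sub>m r"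
proof (induction r)
  case (Suc r)
  then show ?case
    using assoc_mult_mat[OF A pow_carrier_mat[OF A] A, of r] by simp
qed (use A in simp)

lemma transpose_mat_power:
  fixes A :: "'a :: comm_semiring_1 mat"
  assumes A: "A \<in> carrier_mat N N"
  shows "transpose_mat A ^\<^sub>m r = transpose_mat (A ^\<^sub>m r)"
proof (induction r)
  case 0
  show ?case
    using A by simp
next
  case (Suc r)
  show ?case
    unfolding pow_mat_Suc_left[OF A] using A
    by (simp add: Suc.IH transpose_mult[OF A pow_carrier_mat[OF A]])
qed

lemma qexp_transpose_mat:
  assumes "A \<in> carrier_mat N N"
  shows "qexp p (transpose_mat A) = transpose_mat (qexp p A)"
  using assms pow_carrier_mat[OF assms]
  by (auto simp: qexp_def transpose_mat_power[OF assms] intro!: eq_matI)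

text \<open>Transposition reduces this to the upper shift: it swaps the two indices, so the weights
  there are the reciprocals of \<open>u\<close>.\<close>

lemma qexp_lower_shift_mat:
  fixes u :: "nat \<Rightarrow> complex"
  assumes u: "\<And>i. i < N \<Longrightarrow> u i \<noteq> 0"
  shows "qexp p (mat N N (\<lambda>(i, j). if i = Suc j then u i / u j else 0)) =
    mat N N (\<lambda>(i, j). if j \<le> i then u i / (u j * qfact p (i - j)) else 0)"
proof -
  define A where "A = mat N N (\<lambda>(i, j). if j = Suc i then inverse (u i) / inverse (u j) else 0)"
  have "mat N N (\<lambda>(i, j). if i = Suc j then u i / u j else 0) = transpose_mat A"
    by (auto simp: A_def field_simps intro!: eq_matI)
  moreover have "qexp p (transpose_mat A) = transpose_mat (qexp p A)"
    by (rule qexp_transpose_mat[of _ N]) (simp add: A_def)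
  moreover have "qexp p A = mat N N (\<lambda>(i, j). if i \<le> j then
      inverse (u i) / (inverse (u j) * qfact p (j - i)) else 0)"
    unfolding A_def by (rule qexp_shift_mat) (use u in simp)
  ultimately show ?thesis
    by (auto simp: field_simps intro!: eq_matI)
qed

section \<open>Gaussian polynomials and the Gauss identity\<close>

lemma qfact_0 [simp]: "qfact p 0 = 1"
  by (simp add: qfact_def)

lemma qfact_Suc: "qfact p (Suc m) = qfact p m * qnum p (Suc m)"
  by (simp add: qfact_def)

text \<open>For \<open>k < m\<close> the rule comes from splitting
  \<open>(m+1)_p = (k+1)_p + p^(k+1) (m-k)_p\<close> in the numerator.\<close>

lemma qbinom_Pascal:
  assumes "\<And>k. 1 \<le> k \<Longrightarrow> k \<le> Suc m \<Longrightarrow> p ^ k \<noteq> 1"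
  shows "qbinom p (Suc m) (Suc k) = qbinom p m k + p ^ Suc k * qbinom p m (Suc k)"
proof -
  note nz = qfact_nonzero[of "Suc m" p, OF assms]
  consider "m < k" | "k = m" | d where "m = Suc (k + d)"
    by (metis less_imp_Suc_add linorder_less_linear)
  then show ?thesis
  proof cases
    case 3
    have n1: "p \<noteq> 1"
      using assms[of 1] by simp
    have *: "qnum p (Suc m) = qnum p (Suc k) + p ^ Suc k * qnum p (Suc d)"
      using n1 by (simp add: 3 qnum_def divide_simps power_add) (simp add: algebra_simps)
    have "qfact p (Suc k) \<noteq> 0" "qfact p (Suc d) \<noteq> 0"
      using nz[of "Suc k"] nz[of "Suc d"] 3 by auto
    then have nz': "qfact p k \<noteq> 0" "qfact p d \<noteq> 0" "qnum p (Suc k) \<noteq> 0" "qnum p (Suc d) \<noteq> 0"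
      by (auto simp: qfact_Suc)
    have d: "m - k = Suc d" "m - Suc k = d"
      using 3 by auto
    have "qbinom p (Suc m) (Suc k) =
        qfact p m * qnum p (Suc m) / (qfact p (Suc k) * qfact p (Suc d))"
      using 3 d by (simp add: qbinom_def qfact_Suc)
    also have "\<dots> = qfact p m / (qfact p k * qfact p (Suc d)) +
        p ^ Suc k * (qfact p m / (qfact p (Suc k) * qfact p d))"
      unfolding * qfact_Suc using nz' by (simp add: divide_simps) (simp add: algebra_simps)
    finally show ?thesis
      using 3 d by (simp add: qbinom_def)
  qed (use nz in \<open>auto simp: qbinom_def\<close>)
qed

text \<open>Truncating the Gauss sum at \<open>i\<close> gives a closed form suited to induction: in
  the next summand, Pascal's rule produces a \<open>qbinom p m i\<close> term that cancels the
  previous value.\<close>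

lemma qbinom_alternating_partial_sum:
  assumes "\<And>k. 1 \<le> k \<Longrightarrow> k \<le> Suc m \<Longrightarrow> p ^ k \<noteq> 1"
  shows "(\<Sum>j\<le>i. (- 1) ^ j * p ^ (j choose 2) * qbinom p (Suc m) j) =
    (- 1) ^ i * p ^ (Suc i choose 2) * qbinom p m i"
proof (induction i)
  case 0
  show ?case
    using qfact_nonzero[of "Suc m" p, OF assms] by (simp add: qbinom_def binomial_eq_0)
next
  case (Suc i)
  have "Suc (Suc i) choose 2 = (Suc i choose 2) + Suc i"
    by (simp add: numeral_2_eq_2)
  then have c: "p ^ (Suc (Suc i) choose 2) = p ^ Suc i * p ^ (Suc i choose 2)"
    by (simp add: power_add)
  show ?case
    unfolding sum.atMost_Suc Suc.IH c
    by (simp add: qbinom_Pascal[OF assms] algebra_simps)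
qed

text \<open>The full sum is the partial sum whose closed form has the factor
  \<open>qbinom p (m - 1) m\<close>, which is zero.\<close>

lemma qbinom_alternating_sum:
  assumes "\<And>k. 1 \<le> k \<Longrightarrow> k \<le> m \<Longrightarrow> p ^ k \<noteq> 1" and "m > 0"
  shows "(\<Sum>j\<le>m. (- 1) ^ j * p ^ (j choose 2) * qbinom p m j) = 0"
  using assms qbinom_alternating_partial_sum[of "m - 1" p m] by (simp add: qbinom_def)

text \<open>Each factor satisfies \<open>(k)_p = p^(k-1) (k)_(1/p)\<close>, and the exponents
  \<open>0, ..., m - 1\<close> add up to \<open>m choose 2\<close>.\<close>

lemma qfact_inverse:
  assumes "p \<noteq> 0"
  shows "qfact p m = p ^ (m choose 2) * qfact (inverse p) m"
proof (induction m)
  case (Suc m)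
  \<comment> \<open>At \<open>p = 1\<close> both values of \<open>qnum\<close> are divisions by
    zero, hence \<open>0\<close>, and the equation still holds.\<close>
  have "qnum p (Suc m) = p ^ m * qnum (inverse p) (Suc m)"
  proof (cases "p = 1")
    case False
    then have "inverse p - 1 \<noteq> 0"
      by simp
    with False show ?thesis
      using assms by (simp add: qnum_def power_inverse divide_simps) (simp add: algebra_simps)
  qed (simp add: qnum_def)
  moreover have "Suc m choose 2 = (m choose 2) + m"
    by (simp add: numeral_2_eq_2)
  ultimately show ?case
    by (simp add: qfact_Suc Suc.IH power_add)
qed (simp add: binomial_eq_0)

section \<open>The inverse of the Pascal matrix\<close>

lemma mat_inverse_sigma1:
  assumes "\<And>k. 1 \<le> k \<Longrightarrow> k \<le> n \<Longrightarrow> p ^ k \<noteq> 1"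
  shows "mat_inverse (sigma1 p n) = Some (mat (n + 1) (n + 1) (\<lambda>(i, j).
    if i \<le> j then (- 1) ^ (j - i) * p ^ ((j - i) choose 2) * qbinom p (n - i) (n - j) else 0))"
    (is "_ = Some ?C")
proof -
  have "inverse p ^ k \<noteq> 1" if "1 \<le> k" "k \<le> n" for k
    using assms[OF that] by (metis inverse_1 inverse_inverse_eq power_inverse)
  from sigma1_inverse[of n "inverse p", OF this] obtain B where
    B: "mat_inverse (sigma1 p n) = Some B" "B \<in> carrier_mat (n + 1) (n + 1)"
      "B * sigma1 p n = 1\<^sub>m (n + 1)"
    by auto
  have A: "sigma1 p n \<in> carrier_mat (n + 1) (n + 1)"
    by (simp add: sigma1_def)
  have C: "?C \<in> carrier_mat (n + 1) (n + 1)"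
    by simp
  note nz = qfact_nonzero[of n p, OF assms]
  have "sigma1 p n * ?C = 1\<^sub>m (n + 1)"
  proof (rule eq_matI, goal_cases)
    case (1 i j)
    then have ij: "i \<le> n" "j \<le> n"
      by auto
    have "(sigma1 p n * ?C) $$ (i, j) = (\<Sum>l = 0..<n+1. qbinom p (n - i) (n - l) *
        (if l \<le> j then (- 1) ^ (j - l) * p ^ ((j - l) choose 2) * qbinom p (n - l) (n - j) else 0))"
      using ij by (simp add: sigma1_def scalar_prod_def)
    also have "\<dots> = (\<Sum>l \<in> {i..j}. qbinom p (n - i) (n - l) *
        ((- 1) ^ (j - l) * p ^ ((j - l) choose 2) * qbinom p (n - l) (n - j)))"
      using ij by (intro sum.mono_neutral_cong_right) (auto simp: qbinom_def)
    also have "\<dots> = (if i = j then 1 else 0)"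
    proof (cases "i \<le> j")
      case True
      \<comment> \<open>Substituting \<open>t = j - l\<close>, the factor \<open>(n-l)!\<close>
        cancels in the product of the two binomials; expanding by \<open>(j-i)!\<close> leaves a
        constant times \<open>qbinom p (j - i) t\<close>, the Gauss summand.\<close>
      have "(\<Sum>l \<in> {i..j}. qbinom p (n - i) (n - l) *
          ((- 1) ^ (j - l) * p ^ ((j - l) choose 2) * qbinom p (n - l) (n - j))) =
          (\<Sum>t\<le>j - i. qfact p (n - i) / (qfact p (n - j) * qfact p (j - i)) *
            ((- 1) ^ t * p ^ (t choose 2) * qbinom p (j - i) t))"
        using True ij nz
        by (intro sum.reindex_bij_witness[of _ "\<lambda>t. j - t" "\<lambda>l. j - l"])
          (auto simp: qbinom_def field_simps)
      also have "\<dots> = qfact p (n - i) / (qfact p (n - j) * qfact p (j - i)) *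
          (\<Sum>t\<le>j - i. (- 1) ^ t * p ^ (t choose 2) * qbinom p (j - i) t)"
        by (simp add: sum_distrib_left)
      also have "\<dots> = (if i = j then 1 else 0)"
        using qbinom_alternating_sum[of "j - i" p] True ij nz assms
        by (auto simp: qbinom_def binomial_eq_0)
      finally show ?thesis .
    qed simp
    finally show ?case
      using ij by simp
  qed (simp_all add: sigma1_def)
  \<comment> \<open>The left inverse \<open>B\<close> and the right inverse \<open>?C\<close> agree
    by associativity.\<close>
  then have "B = ?C"
    using assoc_mult_mat[OF B(2) A C] B(2,3) C by simp
  with B(1) show ?thesis
    by simp
qed

text \<open>\<open>sharp\<close> replaces \<open>(i, j)\<close> by \<open>(n - i, n - j)\<close>,
  which makes the inverse lower triangular and turns its binomials into
  \<open>qbinom (inverse p) i j\<close>.\<close>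

lemma sigma2_eq:
  assumes "\<And>k. 1 \<le> k \<Longrightarrow> k \<le> n \<Longrightarrow> p ^ k \<noteq> 1"
  shows "sigma2 p n = mat (n + 1) (n + 1) (\<lambda>(i, j). if j \<le> i then
    (- 1) ^ (i - j) * inverse p ^ ((i - j) choose 2) * qbinom (inverse p) i j else 0)"
proof -
  have "inverse p ^ k \<noteq> 1" if "1 \<le> k" "k \<le> n" for k
    using assms[OF that] by (metis inverse_1 inverse_inverse_eq power_inverse)
  from mat_inverse_sigma1[of n "inverse p", OF this] show ?thesis
    by (auto simp: sigma2_def sharp_def intro!: eq_matI)
qed

lemma Dmat_eq: "Dmat p n = mat_diag (n + 1) (\<lambda>r. p ^ (r choose 2))"
  by (simp add: Dmat_def choose_two mult.commute)

section \<open>The arguments of the exponentials\<close>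

text \<open>The factor \<open>q\<close> on the right avoids the exponent \<open>m - 1\<close>, which
  would be truncated at \<open>m = 0\<close>.\<close>

lemma qbracket_eq_qnum:
  assumes "q \<noteq> 0" "q\<^sup>2 \<noteq> 1"
  shows "q ^ m * qbracket q m = q * qnum (q\<^sup>2) m"
proof -
  have d: "q - inverse q \<noteq> 0"
    using assms by (auto simp: field_simps power2_eq_square)
  have "q * qnum (q\<^sup>2) m * (q - inverse q) = q ^ m * (q ^ m - inverse q ^ m)"
    using assms
    by (simp add: qnum_def divide_simps power_inverse flip: power_mult)
       (simp add: algebra_simps power2_eq_square power_mult flip: power_add)
  then show ?thesis
    using d by (simp add: qbracket_def field_simps)
qed

text \<open>The condition on \<open>q\<close> is guarded by \<open>n > 0\<close> because for
  \<open>n = 0\<close> no bracket occurs: both matrices are the zero matrix of size one.\<close>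

lemma rho_E_K_half_eq:
  assumes "q \<noteq> 0" "n > 0 \<longrightarrow> q\<^sup>2 \<noteq> 1" "s\<^sup>2 = q"
  shows "s ^ n \<cdot>\<^sub>m (rho_E q n * rho_K_half s n) =
    mat (n + 1) (n + 1) (\<lambda>(i, j). if j = Suc i then qnum (q\<^sup>2) (n - i) else 0)"
proof (rule eq_matI, goal_cases)
  case (1 i j)
  then have ij: "i \<le> n" "j \<le> n"
    by auto
  have s: "s \<noteq> 0"
    using assms by auto
  have E: "rho_E q n \<in> carrier_mat (n + 1) (n + 1)"
    by (simp add: rho_E_def)
  \<comment> \<open>The diagonal factor belongs to column \<open>i + 1\<close>; the powers of
    \<open>s\<close> combine to \<open>s^(2(n-i-1)) = q^(n-i-1)\<close>.\<close>
  have *: "s ^ n * (qbracket q (n - i) * s powi (int n - 2 * int (i + 1))) = qnum (q\<^sup>2) (n - i)"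
    if "i + 1 \<le> n"
  proof -
    have "s ^ n * s powi (int n - 2 * int (i + 1)) = s powi (2 * (int (n - i) - 1))"
      using s that by (simp add: of_nat_diff algebra_simps flip: power_int_of_nat power_int_add)
    also have "\<dots> = q ^ (n - i) / q"
      using assms s by (simp add: power_int_mult power_int_diff)
    finally have "s ^ n * (qbracket q (n - i) * s powi (int n - 2 * int (i + 1))) =
        q ^ (n - i) * qbracket q (n - i) / q"
      by (metis mult.left_commute mult.commute times_divide_eq_right)
    also have "\<dots> = qnum (q\<^sup>2) (n - i)"
      using assms that by (simp add: qbracket_eq_qnum)
    finally show ?thesis .
  qed
  show ?case
    unfolding rho_K_half_def using ij *
    by (subst mat_diag_mult_right[OF E]) (auto simp: rho_E_def)
qed (simp_all add: rho_E_def rho_K_half_def mat_diag_def)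

lemma rho_F_K_half_inv_eq:
  assumes "q \<noteq> 0" "n > 0 \<longrightarrow> q\<^sup>2 \<noteq> 1" "s\<^sup>2 = q"
  shows "s ^ n \<cdot>\<^sub>m (rho_F q n * rho_K_half_inv s n) =
    mat (n + 1) (n + 1) (\<lambda>(i, j). if i = Suc j then qnum (q\<^sup>2) i else 0)"
proof (rule eq_matI, goal_cases)
  case (1 i j)
  then have ij: "i \<le> n" "j \<le> n"
    by auto
  have s: "s \<noteq> 0"
    using assms by auto
  have F: "rho_F q n \<in> carrier_mat (n + 1) (n + 1)"
    by (simp add: rho_F_def)
  \<comment> \<open>The diagonal factor belongs to column \<open>j = i - 1\<close>, so
    \<open>s^n\<close> cancels and \<open>s^(2j) = q^(i-1)\<close> remains.\<close>
  have *: "s ^ n * (qbracket q i * s powi (- (int n - 2 * int j))) = qnum (q\<^sup>2) i"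
    if "i = j + 1"
  proof -
    have "s ^ n * s powi (- (int n - 2 * int j)) = s powi (2 * (int i - 1))"
      using s that by (simp add: algebra_simps flip: power_int_of_nat power_int_add)
    also have "\<dots> = q ^ i / q"
      using assms s by (simp add: power_int_mult power_int_diff)
    finally have "s ^ n * (qbracket q i * s powi (- (int n - 2 * int j))) =
        q ^ i * qbracket q i / q"
      by (metis mult.left_commute mult.commute times_divide_eq_right)
    also have "\<dots> = qnum (q\<^sup>2) i"
      using assms that ij qbracket_eq_qnum[of q i] by simp
    finally show ?thesis .
  qed
  show ?case
    unfolding rho_K_half_inv_def using ij *
    by (subst mat_diag_mult_right[OF F]) (auto simp: rho_F_def)
qed (simp_all add: rho_F_def rho_K_half_inv_def mat_diag_def)

section \<open>Evaluation of the exponentials and conjugation by the diagonal matrix\<close>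

lemma qexp_qnum_upper:
  assumes "\<And>k. 1 \<le> k \<Longrightarrow> k \<le> n \<Longrightarrow> p ^ k \<noteq> 1"
  shows "qexp p (mat (n + 1) (n + 1) (\<lambda>(i, j). if j = Suc i then qnum p (n - i) else 0)) = sigma1 p n"
proof -
  note nz = qfact_nonzero[of n p, OF assms]
  have "qnum p (n - i) = qfact p (n - i) / qfact p (n - (i + 1))" if "i + 1 \<le> n" for i
    using nz[of "n - (i + 1)"] qfact_Suc[of p "n - (i + 1)"] that by (simp add: Suc_diff_Suc)
  then have "mat (n + 1) (n + 1) (\<lambda>(i, j). if j = Suc i then qnum p (n - i) else 0) =
      mat (n + 1) (n + 1) (\<lambda>(i, j). if j = Suc i then qfact p (n - i) / qfact p (n - j) else 0)"
    by (auto intro!: eq_matI)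
  also have "qexp p \<dots> = mat (n + 1) (n + 1) (\<lambda>(i, j). if i \<le> j then
      qfact p (n - i) / (qfact p (n - j) * qfact p (j - i)) else 0)"
    by (rule qexp_shift_mat) (use nz in auto)
  also have "\<dots> = sigma1 p n"
    by (auto simp: sigma1_def qbinom_def intro!: eq_matI)
  finally show ?thesis .
qed

lemma qexp_qnum_lower:
  assumes "\<And>k. 1 \<le> k \<Longrightarrow> k \<le> n \<Longrightarrow> p ^ k \<noteq> 1"
  shows "qexp p (mat (n + 1) (n + 1) (\<lambda>(i, j). if i = Suc j then - qnum p i else 0)) =
    mat (n + 1) (n + 1) (\<lambda>(i, j). if j \<le> i then (- 1) ^ (i - j) * qbinom p i j else 0)"
proof -
  note nz = qfact_nonzero[of n p, OF assms]
  \<comment> \<open>The alternating sign gives each quotient of neighbours its minus sign and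
    becomes \<open>(-1)^(i-j)\<close> in the exponential.\<close>
  let ?u = "\<lambda>i. (- 1) ^ i * qfact p i"
  have "- qnum p (Suc j) = ?u (Suc j) / ?u j" if "j \<le> n" for j
    using nz[of j] that by (simp add: qfact_Suc)
  then have "mat (n + 1) (n + 1) (\<lambda>(i, j). if i = Suc j then - qnum p i else 0) =
      mat (n + 1) (n + 1) (\<lambda>(i, j). if i = Suc j then ?u i / ?u j else 0)"
    by (auto intro!: eq_matI)
  also have "qexp p \<dots> = mat (n + 1) (n + 1) (\<lambda>(i, j). if j \<le> i then
      ?u i / (?u j * qfact p (i - j)) else 0)"
    by (rule qexp_lower_shift_mat) (use nz in auto)
  also have "\<dots> = mat (n + 1) (n + 1) (\<lambda>(i, j). if j \<le> i then (- 1) ^ (i - j) * qbinom p i j else 0)"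
    by (auto simp: qbinom_def power_diff intro!: eq_matI)
  finally show ?thesis .
qed

text \<open>Entrywise, \<open>qfact_inverse\<close> turns \<open>qbinom p i j\<close> into
  \<open>qbinom (inverse p) i j\<close> times \<open>p\<close> to the power
  \<open>(i choose 2) - (j choose 2) - ((i - j) choose 2)\<close>; the first two exponents come from
  \<open>Dmat\<close>, the last one from \<open>sigma2\<close>.\<close>

lemma Dmat_sigma2:
  assumes "p \<noteq> 0" "\<And>k. 1 \<le> k \<Longrightarrow> k \<le> n \<Longrightarrow> p ^ k \<noteq> 1"
  shows "Dmat p n * sigma2 p n = mat (n + 1) (n + 1) (\<lambda>(i, j).
    if j \<le> i then (- 1) ^ (i - j) * qbinom p i j else 0) * Dmat p n" (is "_ = ?W * _")
proof -
  have W: "?W \<in> carrier_mat (n + 1) (n + 1)" and S: "sigma2 p n \<in> carrier_mat (n + 1) (n + 1)"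
    using sigma2_eq[of n p, OF assms(2)] by simp_all
  show ?thesis
    unfolding Dmat_eq mat_diag_mult_left[OF S] mat_diag_mult_right[OF W]
    using assms(1)
    by (auto simp: sigma2_eq[of n p, OF assms(2)] qbinom_def qfact_inverse[of p] power_inverse
      field_simps intro!: eq_matI)
qed

text \<open>The condition on the powers of \<open>q^2\<close> keeps the factorials up to
  \<open>n\<close> nonzero; \<open>s\<close> is the chosen square root of \<open>q\<close>, so
  \<open>s ^ n\<close> is \<open>q^(n/2)\<close>.\<close>

theorem theorem5:
  fixes q s :: complex and n :: nat
  assumes "q \<noteq> 0" and "q \<noteq> 1"
    and "\<And>m. 1 \<le> m \<Longrightarrow> m \<le> n \<Longrightarrow> (q ^ 2) ^ m \<noteq> 1"
    and "s ^ 2 = q"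
  shows "sigma1 (q ^ 2) n * sharp (Dmat (q ^ 2) n) =
           qexp (q ^ 2) (s ^ n \<cdot>\<^sub>m (rho_E q n * rho_K_half s n)) * sharp (Dmat (q ^ 2) n)
       \<and> Dmat (q ^ 2) n * sigma2 (q ^ 2) n =
           qexp (q ^ 2) (- (s ^ n) \<cdot>\<^sub>m (rho_F q n * rho_K_half_inv s n)) * Dmat (q ^ 2) n"
proof
  have q2: "n > 0 \<longrightarrow> q\<^sup>2 \<noteq> 1"
    using assms(3)[of 1] by simp
  show "sigma1 (q ^ 2) n * sharp (Dmat (q ^ 2) n) =
      qexp (q ^ 2) (s ^ n \<cdot>\<^sub>m (rho_E q n * rho_K_half s n)) * sharp (Dmat (q ^ 2) n)"
    using rho_E_K_half_eq[OF assms(1) q2 assms(4)] qexp_qnum_upper[of n "q\<^sup>2", OF assms(3)] by simp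
  have "- (s ^ n) \<cdot>\<^sub>m (rho_F q n * rho_K_half_inv s n) =
      - (s ^ n \<cdot>\<^sub>m (rho_F q n * rho_K_half_inv s n))"
    by (rule eq_matI) simp_all
  also have "\<dots> = mat (n + 1) (n + 1) (\<lambda>(i, j). if i = Suc j then - qnum (q\<^sup>2) i else 0)"
    unfolding rho_F_K_half_inv_eq[OF assms(1) q2 assms(4)] by (auto intro!: eq_matI)
  finally show "Dmat (q ^ 2) n * sigma2 (q ^ 2) n =
      qexp (q ^ 2) (- (s ^ n) \<cdot>\<^sub>m (rho_F q n * rho_K_half_inv s n)) * Dmat (q ^ 2) n"
    using Dmat_sigma2[of "q\<^sup>2" n, OF _ assms(3)] qexp_qnum_lower[of n "q\<^sup>2", OF assms(3)] assms(1)
    by simp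
qed

end
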